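(* Let $\mathcal{B}$ be a complex unital Banach algebra with identity $I \neq 0$, let $n \geq 1$, and let $A = (A_0, A_1, \dots, A_n)$ be a commutative $(n+1)$-tuple of elements of $\mathcal{B}$, i.e. $A_iA_j = A_jA_i$ for all $0 \leq i, j \leq n$. Then $P(A)$ is a (possibly uncountable) union of hyperplanes of $\mathbb{C}^{n+1}$.
   Context: For $z = (z_0, \dots, z_n) \in \mathbb{C}^{n+1}$ put $A(z) = z_0A_0 + z_1A_1 + \cdots + z_nA_n \in \mathcal{B}$, and $P(A) = \{z \in \mathbb{C}^{n+1} : A(z) \text{ is not invertible in } \mathcal{B}\}$. A hyperplane here means a linear subspace of $\mathbb{C}^{n+1}$ of complex codimension one, i.e. a set $\{z : \sum_{j=0}^n a_j z_j = 0\}$ with $(a_0, \dots, a_n) \neq 0$. *)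

theory Defs
  imports "HOL-Analysis.Analysis"
begin

text \<open>
  The distribution has real Banach algebras only, so the complex scalar multiplication is added
  here.  The type class \<^class>\<open>real_normed_algebra_1\<close> is deliberately not used: it would force the
  identity to have norm one, whereas \<^class>\<open>ring_1\<close> only requires \<open>0 \<noteq> 1\<close>.  The law
  \<open>1 *\<^sub>C x = x\<close> follows from \<open>scaleR_scaleC\<close>.
\<close>

class complex_banach_algebra = real_normed_algebra + ring_1 + banach +
  fixes scaleC :: "complex \<Rightarrow> 'a \<Rightarrow> 'a"  (infixr \<open>*\<^sub>C\<close> 75)
  assumes scaleC_add_right: "c *\<^sub>C (x + y) = c *\<^sub>C x + c *\<^sub>C y"
    and scaleC_add_left: "(c + d) *\<^sub>C x = c *\<^sub>C x + d *\<^sub>C x"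
    and scaleC_scaleC: "c *\<^sub>C d *\<^sub>C x = (c * d) *\<^sub>C x"
    and scaleR_scaleC: "r *\<^sub>R x = complex_of_real r *\<^sub>C x"
    and mult_scaleC_left: "(c *\<^sub>C x) * y = c *\<^sub>C (x * y)"
    and mult_scaleC_right: "x * (c *\<^sub>C y) = c *\<^sub>C (x * y)"
    and norm_scaleC: "norm (c *\<^sub>C x) = cmod c * norm x"

definition invertible_elem :: "'a::monoid_mult \<Rightarrow> bool"
  where "invertible_elem x \<longleftrightarrow> (\<exists>y. x * y = 1 \<and> y * x = 1)"

definition pencil :: "'a::complex_banach_algebra ^ 'k \<Rightarrow> complex ^ 'k \<Rightarrow> 'a"
  where "pencil A z = (\<Sum>j\<in>UNIV. (z $ j) *\<^sub>C (A $ j))"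

definition proj_spectrum :: "'a::complex_banach_algebra ^ 'k \<Rightarrow> (complex ^ 'k) set"
  where "proj_spectrum A = {z. \<not> invertible_elem (pencil A z)}"

text \<open>
  The sum is bilinear, without conjugation, so it is not the Hermitian inner product.
\<close>

definition complex_hyperplane :: "(complex ^ 'k) set \<Rightarrow> bool"
  where "complex_hyperplane H \<longleftrightarrow> (\<exists>a. a \<noteq> 0 \<and> H = {z. (\<Sum>j\<in>UNIV. a $ j * z $ j) = 0})"

end

theory Submission
  imports Defs
begin

text \<open>
  The bicommutant \<open>M\<close> of the tuple is commutative and contains the inverses of its invertible
  elements, so if \<open>A(z)\<close> is not invertible, then it generates a proper ideal \<open>J\<close> of \<open>M\<close>.  By a
  version of the Gelfand--Mazur theorem relative to \<open>J\<close>, each \<open>A\<^sub>j\<close> in turn has a \<open>\<lambda>\<^sub>j\<close> such that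
  adjoining \<open>A\<^sub>j - \<lambda>\<^sub>j\<close> keeps the ideal proper.  Modulo the final ideal \<open>A(w)\<close> is the scalar
  \<open>\<Sum>j. \<lambda>\<^sub>j w\<^sub>j\<close>; this vanishes at \<open>w = z\<close>, and wherever it vanishes \<open>A(w)\<close> is not invertible.
  If all \<open>\<lambda>\<^sub>j\<close> are zero, every hyperplane through \<open>z\<close> will do; one exists because \<open>n \<ge> 1\<close>.
\<close>

section \<open>Complex scalar multiplication\<close>

lemma scaleC_zero_left [simp]: "0 *\<^sub>C x = 0"
  for x :: "'a::complex_banach_algebra"
  using scaleC_add_left[of 0 0 x] by simp

lemma scaleC_zero_right [simp]: "c *\<^sub>C 0 = (0::'a::complex_banach_algebra)"
  using scaleC_add_right[of c 0 "0::'a"] by simp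

lemma scaleC_one [simp]: "1 *\<^sub>C x = x"
  for x :: "'a::complex_banach_algebra"
  using scaleR_scaleC[of 1 x] by simp

lemma scaleC_minus_left: "(- c) *\<^sub>C x = - (c *\<^sub>C x)"
  for x :: "'a::complex_banach_algebra"
  using scaleC_add_left[of "- c" c x] by (simp add: eq_neg_iff_add_eq_0)

lemma scaleC_minus_right: "c *\<^sub>C (- x) = - (c *\<^sub>C x)"
  for x :: "'a::complex_banach_algebra"
  using scaleC_add_right[of c "- x" x] by (simp add: eq_neg_iff_add_eq_0)

lemma scaleC_diff_left: "(c - d) *\<^sub>C x = c *\<^sub>C x - d *\<^sub>C x"
  for x :: "'a::complex_banach_algebra"
  using scaleC_add_left[of c "- d" x] by (simp add: scaleC_minus_left)

lemma scaleC_diff_right: "c *\<^sub>C (x - y) = c *\<^sub>C x - c *\<^sub>C y"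
  for x :: "'a::complex_banach_algebra"
  using scaleC_add_right[of c x "- y"] by (simp add: scaleC_minus_right)

lemma scaleC_sum_right: "c *\<^sub>C sum f S = (\<Sum>i\<in>S. c *\<^sub>C (f i :: 'a::complex_banach_algebra))"
  by (induction S rule: infinite_finite_induct) (auto simp: scaleC_add_right)

lemma scaleC_sum_left: "sum c S *\<^sub>C x = (\<Sum>i\<in>S. c i *\<^sub>C x)"
  for x :: "'a::complex_banach_algebra"
  by (induction S rule: infinite_finite_induct) (auto simp: scaleC_add_left)

section \<open>Neumann series and sums over roots of unity\<close>

text \<open>Neumann series: the powers of \<open>1 - x\<close> sum to the inverse. Since
  \<open>norm 1\<close> may exceed one, it enters the geometric bound as a factor.\<close>

lemma invertible_elem_near_one:
  fixes x :: "'a::complex_banach_algebra"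
  assumes "norm (1 - x) < 1"
  shows "invertible_elem x"
proof -
  define t where "t = 1 - x"
  have bound: "norm (t ^ n) \<le> norm (1::'a) * norm t ^ n" for n
  proof (induction n)
    case (Suc n)
    have "norm (t ^ Suc n) \<le> norm t * norm (t ^ n)"
      by (simp add: norm_mult_ineq)
    also have "\<dots> \<le> norm t * (norm (1::'a) * norm t ^ n)"
      by (intro mult_left_mono Suc) auto
    finally show ?case by (simp add: mult_ac)
  qed simp
  have "summable (\<lambda>n. norm (1::'a) * norm t ^ n)"
    using assms by (intro summable_mult summable_geometric) (auto simp: t_def)
  then have sm: "summable (\<lambda>n. t ^ n)"
    by (rule summable_comparison_test') (use bound in auto)
  define s where "s = (\<Sum>n. t ^ n)"
  have shift: "(\<Sum>n. t ^ Suc n) = s - 1"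
    using suminf_split_head[OF sm] by (simp add: s_def)
  have "t * s = s - 1"
    using suminf_mult[OF sm, of t] shift by (simp add: s_def)
  moreover have "s * t = s - 1"
    using suminf_mult2[OF sm, of t] shift by (simp add: s_def power_commutes)
  ultimately have "x * s = 1" "s * x = 1"
    by (auto simp: t_def algebra_simps)
  then show ?thesis
    by (auto simp: invertible_elem_def)
qed

text \<open>A geometric sum whose ratio \<open>w\<close> is an \<open>n\<close>-th root of unity,
  and \<open>w \<noteq> 1\<close> because \<open>n\<close> does not divide \<open>i\<close>.\<close>

lemma sum_powers_root_of_unity:
  fixes i n :: nat
  assumes "0 < i" "i < n"
  shows "(\<Sum>k<n. (c * cis (2 * pi * k / n)) ^ i) = 0"
proof -
  define w where "w = cis (2 * pi * i / n)"
  have "w \<noteq> 1"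
  proof
    assume "w = 1"
    then have "cos (2 * pi * i / n) = 1"
      by (simp add: w_def cis.ctr complex_eq_iff)
    then obtain l :: int where "2 * pi * i / n = l * 2 * pi"
      by (auto simp: cos_one_2pi_int)
    then have "real i = real_of_int l * n"
      using assms by (simp add: field_simps)
    then have "int i = l * int n"
      by (metis of_int_eq_iff of_int_mult of_int_of_nat_eq)
    then show False
      using assms by (metis gr_implies_not0 zdvd_not_zless dvd_triv_right of_nat_0_less_iff of_nat_less_iff)
  qed
  moreover have "w ^ n = 1"
    using assms by (simp add: w_def Complex.DeMoivre)
  ultimately have "(\<Sum>k<n. w ^ k) = 0"
    by (simp add: sum_gp_strict)
  moreover have "(c * cis (2 * pi * k / n)) ^ i = c ^ i * w ^ k" for k :: nat
    by (simp add: w_def Complex.DeMoivre power_mult_distrib mult_ac)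
  ultimately show ?thesis
    by (simp flip: sum_distrib_left)
qed

section \<open>Commutative subalgebras and their proper ideals\<close>

text \<open>The law \<open>inverse_mem\<close> makes invertibility in \<open>M\<close> agree with
  invertibility in the whole algebra.\<close>

locale full_commutative_subalgebra =
  fixes M :: "'a::complex_banach_algebra set"
  assumes one_mem: "1 \<in> M"
    and add_mem: "x \<in> M \<Longrightarrow> y \<in> M \<Longrightarrow> x + y \<in> M"
    and mult_mem: "x \<in> M \<Longrightarrow> y \<in> M \<Longrightarrow> x * y \<in> M"
    and scaleC_mem: "x \<in> M \<Longrightarrow> c *\<^sub>C x \<in> M"
    and commute: "x \<in> M \<Longrightarrow> y \<in> M \<Longrightarrow> x * y = y * x"
    and inverse_mem: "x \<in> M \<Longrightarrow> x * y = 1 \<Longrightarrow> y * x = 1 \<Longrightarrow> y \<in> M"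
begin

lemma zero_mem: "0 \<in> M"
  using scaleC_mem[OF one_mem, of 0] by simp

lemma diff_mem: "x \<in> M \<Longrightarrow> y \<in> M \<Longrightarrow> x - y \<in> M"
  using add_mem[of x "(-1) *\<^sub>C y"] scaleC_mem[of y "-1"] by (simp add: scaleC_minus_left)

lemma sum_mem: "(\<And>i. i \<in> S \<Longrightarrow> f i \<in> M) \<Longrightarrow> sum f S \<in> M"
  by (induction S rule: infinite_finite_induct) (auto intro: zero_mem add_mem)

lemma power_mem: "x \<in> M \<Longrightarrow> x ^ n \<in> M"
  by (induction n) (auto intro: one_mem mult_mem)

end

locale proper_ideal = full_commutative_subalgebra M
  for M :: "'a::complex_banach_algebra set" +
  fixes J :: "'a set"
  assumes ideal_subset: "J \<subseteq> M"
    and ideal_zero: "0 \<in> J"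
    and ideal_add: "x \<in> J \<Longrightarrow> y \<in> J \<Longrightarrow> x + y \<in> J"
    and ideal_mult: "x \<in> M \<Longrightarrow> y \<in> J \<Longrightarrow> x * y \<in> J"
    and ideal_proper: "1 \<notin> J"
begin

lemma ideal_mult': "x \<in> J \<Longrightarrow> y \<in> M \<Longrightarrow> x * y \<in> J"
  using ideal_mult[of y x] commute[of x y] ideal_subset by auto

lemma ideal_scaleC: "x \<in> J \<Longrightarrow> c *\<^sub>C x \<in> J"
  using ideal_mult[OF scaleC_mem[OF one_mem], of x c] by (simp add: mult_scaleC_left)

lemma ideal_diff: "x \<in> J \<Longrightarrow> y \<in> J \<Longrightarrow> x - y \<in> J"
  using ideal_add[of x "(-1) *\<^sub>C y"] ideal_scaleC[of y "-1"] by (simp add: scaleC_minus_left)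

lemma ideal_sum: "(\<And>i. i \<in> S \<Longrightarrow> f i \<in> J) \<Longrightarrow> sum f S \<in> J"
  by (induction S rule: infinite_finite_induct) (auto intro: ideal_zero ideal_add)

lemma not_invertible_ideal:
  assumes "x \<in> J"
  shows "\<not> invertible_elem x"
proof
  assume "invertible_elem x"
  then obtain y where y: "x * y = 1" "y * x = 1"
    by (auto simp: invertible_elem_def)
  then have "y \<in> M"
    using assms ideal_subset inverse_mem by blast
  then show False
    using ideal_mult[of y x] assms y ideal_proper by simp
qed

section \<open>The quotient seminorm modulo an ideal\<close>

text \<open>The quotient seminorm modulo \<open>J\<close>; its zero set is the closure of
  \<open>J\<close>.\<close>

definition q :: "'a \<Rightarrow> real"
  where "q x = infdist x J"

lemma q_nonneg: "0 \<le> q x"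
  by (simp add: q_def infdist_nonneg)

lemma q_le: "j \<in> J \<Longrightarrow> q x \<le> norm (x - j)"
  by (metis q_def infdist_le dist_norm)

lemma q_less: "q x < r \<Longrightarrow> \<exists>j\<in>J. norm (x - j) < r"
  using ideal_zero cINF_less_iff[of J "dist x" r]
  by (auto simp: q_def infdist_def simp flip: dist_norm split: if_splits)

lemma q_ideal: "x \<in> J \<Longrightarrow> q x = 0"
  by (simp add: q_def)

lemma q_add: "q (x + y) \<le> q x + q y"
proof (rule field_le_epsilon)
  fix e :: real assume "0 < e"
  obtain j where j: "j \<in> J" "norm (x - j) < q x + e / 2"
    using q_less[of x "q x + e / 2"] \<open>0 < e\<close> by auto
  obtain k where k: "k \<in> J" "norm (y - k) < q y + e / 2"
    using q_less[of y "q y + e / 2"] \<open>0 < e\<close> by auto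
  have "q (x + y) \<le> norm ((x - j) + (y - k))"
    using q_le[OF ideal_add[OF j(1) k(1)], of "x + y"] by (simp add: algebra_simps)
  also have "\<dots> \<le> norm (x - j) + norm (y - k)"
    by (rule norm_triangle_ineq)
  finally show "q (x + y) \<le> q x + q y + e"
    using j k by simp
qed

text \<open>For nearly optimal \<open>j\<close> and \<open>k\<close> in \<open>J\<close>, the
  product \<open>(x - j) * (y - k)\<close> is congruent to \<open>x * y\<close> modulo
  \<open>J\<close>; then the error \<open>e\<close> tends to 0.\<close>

lemma q_mult:
  assumes "x \<in> M" "y \<in> M"
  shows "q (x * y) \<le> q x * q y"
proof (rule tendsto_lowerbound)
  show "((\<lambda>e. (q x + e) * (q y + e)) \<longlongrightarrow> q x * q y) (at_right 0)"
    by (auto intro!: tendsto_eq_intros)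
  show "\<forall>\<^sub>F e in at_right 0. q (x * y) \<le> (q x + e) * (q y + e)"
    unfolding eventually_at_right_field
  proof (intro exI[of _ 1] conjI allI impI)
    fix e :: real assume "0 < e"
    obtain j where j: "j \<in> J" "norm (x - j) < q x + e"
      using q_less[of x "q x + e"] \<open>0 < e\<close> by auto
    obtain k where k: "k \<in> J" "norm (y - k) < q y + e"
      using q_less[of y "q y + e"] \<open>0 < e\<close> by auto
    have "j * y + (x - j) * k \<in> J"
      using j k assms ideal_subset by (intro ideal_add ideal_mult ideal_mult' diff_mem) auto
    then have "q (x * y) \<le> norm (x * y - (j * y + (x - j) * k))"
      by (rule q_le)
    also have "x * y - (j * y + (x - j) * k) = (x - j) * (y - k)"
      by (simp add: algebra_simps)
    also have "norm \<dots> \<le> norm (x - j) * norm (y - k)"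
      by (rule norm_mult_ineq)
    also have "\<dots> \<le> (q x + e) * (q y + e)"
      using j k q_nonneg \<open>0 < e\<close> by (intro mult_mono) (auto intro: add_nonneg_nonneg)
    finally show "q (x * y) \<le> (q x + e) * (q y + e)" .
  qed simp
qed simp

lemma q_scaleC_le: "q (c *\<^sub>C x) \<le> cmod c * q x"
proof (cases "c = 0")
  case True
  then show ?thesis by (simp add: q_ideal ideal_zero)
next
  case False
  show ?thesis
  proof (rule field_le_epsilon)
    fix e :: real assume "0 < e"
    then have "q x < q x + e / cmod c"
      using False by simp
    then obtain j where j: "j \<in> J" "norm (x - j) < q x + e / cmod c"
      using q_less by blast
    have "q (c *\<^sub>C x) \<le> cmod c * norm (x - j)"
      using q_le[OF ideal_scaleC[OF j(1), of c], of "c *\<^sub>C x"]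
      by (simp add: norm_scaleC flip: scaleC_diff_right)
    also have "\<dots> \<le> cmod c * (q x + e / cmod c)"
      using j by (intro mult_left_mono) auto
    finally show "q (c *\<^sub>C x) \<le> cmod c * q x + e"
      using False by (simp add: distrib_left)
  qed
qed

lemma q_scaleC: "q (c *\<^sub>C x) = cmod c * q x"
proof (cases "c = 0")
  case True
  then show ?thesis by (simp add: q_ideal ideal_zero)
next
  case False
  have "q x = q ((1 / c) *\<^sub>C (c *\<^sub>C x))"
    using False by (simp add: scaleC_scaleC)
  also have "\<dots> \<le> cmod (1 / c) * q (c *\<^sub>C x)"
    by (rule q_scaleC_le)
  finally have "cmod c * q x \<le> q (c *\<^sub>C x)"
    using False by (simp add: norm_divide field_simps)
  with q_scaleC_le[of c x] show ?thesis by simp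
qed

lemma q_cong:
  assumes "x - y \<in> J"
  shows "q x = q y"
proof (rule antisym)
  show "q x \<le> q y"
    using q_add[of y "x - y"] q_ideal[OF assms] by simp
  show "q y \<le> q x"
    using q_add[of x "0 - (x - y)"] q_ideal[OF ideal_diff[OF ideal_zero assms]] by simp
qed

lemma q_sum: "q (sum f S) \<le> (\<Sum>i\<in>S. q (f i))"
proof (induction S rule: infinite_finite_induct)
  case (insert i S)
  then show ?case
    using q_add[of "f i" "sum f S"] by simp
qed (auto simp: q_ideal ideal_zero)

text \<open>The factor \<open>y\<close> keeps \<open>q 1\<close>, which may exceed one, out of the
  bound at \<open>n = 0\<close>.\<close>

lemma q_power_mult:
  assumes "x \<in> M" "y \<in> M"
  shows "q (x ^ n * y) \<le> q x ^ n * q y"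
proof (induction n)
  case (Suc n)
  have "q (x ^ Suc n * y) = q (x * (x ^ n * y))"
    by (simp add: mult.assoc)
  also have "\<dots> \<le> q x * q (x ^ n * y)"
    by (intro q_mult mult_mem power_mem assms)
  also have "\<dots> \<le> q x * (q x ^ n * q y)"
    by (intro mult_left_mono Suc q_nonneg)
  finally show ?case by (simp add: mult_ac)
qed simp

text \<open>An element of \<open>J\<close> at distance less than one from the identity would be
  invertible.\<close>

lemma q_one_ge: "1 \<le> q 1"
proof (rule ccontr)
  assume "\<not> 1 \<le> q 1"
  then obtain j where "j \<in> J" "norm (1 - j) < 1"
    using q_less[of 1 1] by auto
  then show False
    using invertible_elem_near_one not_invertible_ideal by blast
qed

section \<open>A Gelfand-Mazur theorem modulo an ideal\<close>

text \<open>
  Here \<open>b\<close> is a resolvent of \<open>x\<close> modulo \<open>J\<close>; write \<open>b\<^sub>c\<close> for \<open>b (l + c)\<close>.  Averaging the \<open>n\<close>-fold iterate of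
  \<open>b\<^sub>c = y + c y b\<^sub>c\<close>, where \<open>y = b\<^sub>0\<close>, over the \<open>n\<close> values \<open>c = h \<omega>\<^sup>k\<close> for a primitive root of unity
  \<open>\<omega>\<close> kills all intermediate terms: a mean value property of the resolvent without integrals.
\<close>

lemma resolvent_mean_value:
  fixes l h :: complex and n :: nat
  assumes b: "\<And>c. b c \<in> M" "\<And>c. b c * (x - c *\<^sub>C 1) - 1 \<in> J"
    and "x \<in> M"
  defines "w \<equiv> \<lambda>k::nat. l + h * cis (2 * pi * k / n)"
  assumes "0 < n"
  shows "(\<Sum>k<n. b (w k)) - (of_nat n *\<^sub>C b l + h ^ n *\<^sub>C (b l ^ n * (\<Sum>k<n. b (w k)))) \<in> J"
proof -
  define y where "y = b l"
  have y: "y \<in> M" "y * (x - l *\<^sub>C 1) - 1 \<in> J"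
    using b by (auto simp: y_def)
  have step: "b (l + c) - (y + c *\<^sub>C (y * b (l + c))) \<in> J" for c
  proof -
    \<comment> \<open>Both products contain \<open>y * b (l + c) * x\<close>, which cancels in their
      difference and leaves the resolvent identity.\<close>
    have "y * (b (l + c) * (x - (l + c) *\<^sub>C 1) - 1) \<in> J"
      using ideal_mult y b by blast
    moreover have "b (l + c) * (y * (x - l *\<^sub>C 1) - 1) \<in> J"
      using ideal_mult y b by blast
    ultimately have "y * (b (l + c) * (x - (l + c) *\<^sub>C 1) - 1)
        - b (l + c) * (y * (x - l *\<^sub>C 1) - 1) \<in> J"
      by (rule ideal_diff)
    moreover have "b (l + c) * y = y * b (l + c)"
      by (intro commute b y)
    moreover from this have "b (l + c) * (y * z) = y * (b (l + c) * z)" for z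
      by (simp flip: mult.assoc)
    ultimately show ?thesis
      by (simp add: algebra_simps mult_scaleC_right mult_scaleC_left scaleC_add_left)
  qed
  have iter: "b (l + c) - ((\<Sum>i<m. c ^ i *\<^sub>C y ^ Suc i) + c ^ m *\<^sub>C (y ^ m * b (l + c))) \<in> J" for c m
  proof (induction m)
    case 0
    then show ?case by (simp add: ideal_zero)
  next
    case (Suc m)
    \<comment> \<open>Substituting \<open>step\<close> into the remainder splits off the next term
      of the geometric sum.\<close>
    have "c ^ m *\<^sub>C (y ^ m * (b (l + c) - (y + c *\<^sub>C (y * b (l + c))))) \<in> J"
      by (intro ideal_scaleC ideal_mult power_mem y step)
    from ideal_add[OF Suc this] show ?case
      by (simp add: algebra_simps scaleC_add_right scaleC_diff_right mult_scaleC_right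
          scaleC_scaleC power_commutes flip: mult.assoc)
  qed
  define c where "c = (\<lambda>k::nat. h * cis (2 * pi * k / n))"
  \<comment> \<open>All \<open>c k\<close> have the same \<open>n\<close>-th power, so this factor
    comes out of the sum of the remainders.\<close>
  have cn: "c k ^ n = h ^ n" for k
    using \<open>0 < n\<close> by (simp add: c_def power_mult_distrib Complex.DeMoivre)
  have "(\<Sum>k<n. b (w k) - ((\<Sum>i<n. c k ^ i *\<^sub>C y ^ Suc i) + c k ^ n *\<^sub>C (y ^ n * b (w k)))) \<in> J"
    unfolding w_def c_def by (intro ideal_sum iter)
  moreover have "(\<Sum>k<n. \<Sum>i<n. c k ^ i *\<^sub>C y ^ Suc i) = of_nat n *\<^sub>C y"
  proof -
    have "(\<Sum>k<n. \<Sum>i<n. c k ^ i *\<^sub>C y ^ Suc i) = (\<Sum>i<n. (\<Sum>k<n. c k ^ i) *\<^sub>C y ^ Suc i)"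
      by (subst sum.swap) (simp add: scaleC_sum_left)
    also have "\<dots> = (\<Sum>i<n. if i = 0 then of_nat n *\<^sub>C y else 0)"
      by (intro sum.cong) (auto simp: c_def sum_powers_root_of_unity)
    also have "\<dots> = of_nat n *\<^sub>C y"
      using \<open>0 < n\<close> by (simp add: sum.delta)
    finally show ?thesis .
  qed
  ultimately show ?thesis
    by (simp add: cn sum_subtractf sum.distrib y_def sum_distrib_left scaleC_sum_right)
qed

text \<open>
  \<open>1 / q (b c)\<close> is Lipschitz and tends to infinity, so it has a minimum \<open>m > 0\<close>; by the mean value
  property it equals \<open>m\<close> at distance \<open>m / 2\<close> from any minimum, hence at arbitrarily distant points.
\<close>

lemma ex_eigenvalue_mod:
  assumes "x \<in> M"
  shows "\<exists>c. \<forall>b\<in>M. b * (x - c *\<^sub>C 1) - 1 \<notin> J"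
proof (rule ccontr)
  assume "\<not> ?thesis"
  then have "\<forall>c. \<exists>b. b \<in> M \<and> b * (x - c *\<^sub>C 1) - 1 \<in> J"
    by blast
  then obtain b where b: "\<And>c. b c \<in> M" "\<And>c. b c * (x - c *\<^sub>C 1) - 1 \<in> J"
    by metis
  have xc: "x - c *\<^sub>C 1 \<in> M" for c
    by (intro diff_mem scaleC_mem one_mem assms)
  define f where "f = (\<lambda>c. q (b c))"
  have pos: "0 < f c" for c
  proof -
    \<comment> \<open>The product is congruent to 1 modulo \<open>J\<close>, so neither factor can
      have seminorm zero.\<close>
    have "1 \<le> q (b c * (x - c *\<^sub>C 1))"
      using q_cong[OF b(2)] q_one_ge by simp
    also have "\<dots> \<le> f c * q (x - c *\<^sub>C 1)"
      unfolding f_def by (intro q_mult b xc)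
    finally have "f c \<noteq> 0" by auto
    then show ?thesis
      using q_nonneg[of "b c"] by (simp add: f_def)
  qed
  define g where "g = (\<lambda>c. 1 / f c)"
  have gpos: "0 < g c" for c
    using pos by (simp add: g_def)
  have lip: "f c - f d \<le> cmod (c - d) * (f c * f d)" for c d
  proof -
    \<comment> \<open>Again the resolvent identity modulo \<open>J\<close>, now between the
      parameters \<open>c\<close> and \<open>d\<close>.\<close>
    have "b d * (b c * (x - c *\<^sub>C 1) - 1) \<in> J" "b c * (b d * (x - d *\<^sub>C 1) - 1) \<in> J"
      by (intro ideal_mult b)+
    from ideal_diff[OF this]
    have "b c - (b d + (c - d) *\<^sub>C (b c * b d)) \<in> J"
      using commute[OF b(1)[of c] b(1)[of d]]
      by (simp add: algebra_simps mult_scaleC_right scaleC_diff_left flip: mult.assoc)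
    then have "f c = q (b d + (c - d) *\<^sub>C (b c * b d))"
      unfolding f_def by (rule q_cong)
    also have "\<dots> \<le> f d + cmod (c - d) * q (b c * b d)"
      using q_add[of "b d" "(c - d) *\<^sub>C (b c * b d)"] by (simp add: f_def q_scaleC)
    also have "\<dots> \<le> f d + cmod (c - d) * (f c * f d)"
      unfolding f_def by (intro add_left_mono mult_left_mono q_mult b) auto
    finally show ?thesis by simp
  qed
  have glip: "g d - g c \<le> cmod (c - d)" for c d
    using lip[of c d] pos[of c] pos[of d] by (simp add: g_def field_simps)
  have "1-lipschitz_on UNIV g"
    by (rule lipschitz_onI) (use glip in \<open>auto simp: dist_norm abs_le_iff, metis norm_minus_commute\<close>)
  then have cont: "continuous_on S g" for S
    by (meson lipschitz_on_continuous_on continuous_on_subset subset_UNIV)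
  \<comment> \<open>Modulo \<open>J\<close>, \<open>c *\<^sub>C b c\<close> is
    \<open>b c * x - 1\<close>; take seminorms and divide by \<open>f c\<close>. Hence
    \<open>g\<close> grows at least linearly.\<close>
  have coerc: "cmod c \<le> q x + g c * q 1" for c
  proof -
    have "b c * x - 1 - c *\<^sub>C b c \<in> J"
      using b(2)[of c] by (simp add: algebra_simps mult_scaleC_right)
    then have "cmod c * f c = q (b c * x + (-1) *\<^sub>C 1)"
      using q_cong[of "b c * x - 1" "c *\<^sub>C b c"] by (simp add: f_def q_scaleC scaleC_minus_left)
    also have "\<dots> \<le> f c * q x + q 1"
      using q_add[of "b c * x" "(-1) *\<^sub>C 1"] q_mult[OF b(1)[of c] assms]
      by (simp only: q_scaleC f_def) simp
    finally show ?thesis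
      using pos[of c] by (simp add: g_def field_simps)
  qed
  obtain l0 where l0: "\<And>c. g l0 \<le> g c"
  proof -
    \<comment> \<open>Outside the disc of radius \<open>R\<close>, \<open>coerc\<close> forces
      \<open>g c > g 0\<close>, so a minimum over this compact disc is global.\<close>
    define R where "R = q x + g 0 * q 1"
    have R: "0 \<le> R"
      using q_nonneg gpos[of 0] by (auto simp: R_def intro!: add_nonneg_nonneg mult_nonneg_nonneg)
    obtain l0 where l0: "l0 \<in> cball 0 R" "\<And>c. c \<in> cball 0 R \<Longrightarrow> g l0 \<le> g c"
      using continuous_attains_inf[of "cball 0 R" g] cont R by auto
    have "g l0 \<le> g c" for c
    proof (cases "c \<in> cball 0 R")
      case False
      then have "g 0 * q 1 < g c * q 1"
        using coerc[of c] by (simp add: R_def)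
      then have "g 0 < g c"
        using q_one_ge by simp
      then show ?thesis
        using l0(2)[of 0] R by simp
    qed (use l0 in auto)
    then show ?thesis by (rule that)
  qed
  define m where "m = g l0"
  have m: "0 < m" and mle: "\<And>c. m \<le> g c"
    using gpos l0 by (auto simp: m_def)
  have fle: "f c \<le> 1 / m" for c
    using mle[of c] pos[of c] m by (simp add: g_def field_simps)
  have spread: "g (l + of_real (m / 2)) = m" if gl: "g l = m" for l
  proof -
    \<comment> \<open>With \<open>f l = 1 / m\<close> this radius gives
      \<open>h * f l = 1 / 2\<close>, so the remainder in the mean value property decays like
      \<open>(1 / 2) ^ n\<close>.\<close>
    define h where "h = m / 2"
    have fl: "f l = 1 / m"
      using gl pos[of l] m by (auto simp: g_def field_simps)
    \<comment> \<open>All values of \<open>f\<close> are at most \<open>1 / m\<close>, and their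
      average over the circle is nearly that large. Bounding all but the value at
      \<open>w 0 = l + h\<close> by \<open>1 / m\<close> costs a factor \<open>n\<close> in the
      error, which the exponential decay absorbs.\<close>
    have est: "1 / m \<le> f (l + of_real h) + (1 / m) * (real n * (1 / 2) ^ n)" if "0 < n" for n
    proof -
      define w where "w = (\<lambda>k::nat. l + of_real h * cis (2 * pi * k / n))"
      define S where "S = (\<Sum>k<n. b (w k))"
      have S: "S \<in> M"
        unfolding S_def by (intro sum_mem b)
      have "S - (of_nat n *\<^sub>C b l + of_real h ^ n *\<^sub>C (b l ^ n * S)) \<in> J"
        unfolding S_def w_def using resolvent_mean_value[of b x n l "of_real h"] b assms that by blast
      then have "q (of_nat n *\<^sub>C b l) = q (S + (- (of_real h ^ n)) *\<^sub>C (b l ^ n * S))"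
        by (intro sym[OF q_cong]) (simp add: algebra_simps scaleC_minus_left)
      also have "\<dots> \<le> q S + h ^ n * q (b l ^ n * S)"
        using q_add[of S "(- (of_real h ^ n)) *\<^sub>C (b l ^ n * S)"] m
        by (simp add: q_scaleC norm_power h_def)
      also have "\<dots> \<le> q S + h ^ n * (f l ^ n * q S)"
        using m unfolding f_def
        by (intro add_left_mono mult_left_mono q_power_mult b S) (auto simp: h_def)
      also have "\<dots> = q S + (1 / 2) ^ n * q S"
        using m by (simp add: fl h_def power_divide)
      finally have 1: "n / m \<le> q S + (1 / 2) ^ n * q S"
        using fl by (simp add: q_scaleC f_def)
      have "q S \<le> (\<Sum>k<n. f (w k))"
        unfolding S_def f_def by (rule q_sum)
      also have "\<dots> = f (w 0) + (\<Sum>k\<in>{1..<n}. f (w k))"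
        using that by (simp add: lessThan_atLeast0 sum.atLeast_Suc_lessThan)
      also have "\<dots> \<le> f (w 0) + (\<Sum>k\<in>{1..<n}. 1 / m)"
        by (intro add_left_mono sum_mono fle)
      also have "\<dots> = f (l + of_real h) + (real n - 1) / m"
        using that by (simp add: w_def of_nat_diff)
      finally have 2: "q S \<le> f (l + of_real h) + (real n - 1) / m" .
      also have "\<dots> \<le> n / m"
        using fle[of "l + of_real h"] by (simp add: diff_divide_distrib)
      finally have "(1 / 2) ^ n * q S \<le> (1 / 2) ^ n * (n / m)"
        by (intro mult_left_mono) auto
      with 1 2 show ?thesis
        by (simp add: diff_divide_distrib mult_ac)
    qed
    have null: "(\<lambda>n. real n * (1 / 2) ^ n) \<longlonglongrightarrow> 0"
      using powser_times_n_limit_0[of "1 / 2 :: real"] by simp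
    have lim: "(\<lambda>n. f (l + of_real h) + (1 / m) * (real n * (1 / 2) ^ n)) \<longlonglongrightarrow> f (l + of_real h)"
      using tendsto_add[OF tendsto_const tendsto_mult_right_zero[OF null]] by (simp only: add_0_right)
    have "1 / m \<le> f (l + of_real h)"
      by (rule LIMSEQ_le_const[OF lim]) (use est in \<open>auto intro!: exI[of _ 1]\<close>)
    with fle[of "l + of_real h"] have "f (l + of_real h) = 1 / m"
      by simp
    then show ?thesis
      by (simp add: g_def h_def)
  qed
  have walk: "g (l0 + of_real (of_nat k * (m / 2))) = m" for k
  proof (induction k)
    case (Suc k)
    then show ?case
      using spread[OF Suc] by (simp add: algebra_simps add_divide_distrib)
  qed (simp add: m_def)
  \<comment> \<open>Where \<open>g\<close> equals \<open>m\<close>, \<open>coerc\<close> bounds the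
    modulus by \<open>q x + m * q 1\<close>; \<open>k\<close> steps of length \<open>m / 2\<close>
    from \<open>l0\<close> lead beyond that.\<close>
  obtain k :: nat where k: "cmod l0 + q x + m * q 1 < k * (m / 2)"
    using reals_Archimedean3[of "m / 2"] m half_gt_zero by blast
  have "k * (m / 2) = cmod (of_real (of_nat k * (m / 2)))"
    using m by (simp only: norm_of_real) simp
  also have "\<dots> \<le> cmod (l0 + of_real (of_nat k * (m / 2))) + cmod l0"
    using norm_triangle_ineq4[of "l0 + of_real (of_nat k * (m / 2))" l0] by simp
  also have "\<dots> \<le> q x + m * q 1 + cmod l0"
    using coerc[of "l0 + of_real (of_nat k * (m / 2))"] by (simp only: walk)
  finally show False
    using k by simp
qed

section \<open>Enlarging ideals to obtain joint eigenvalues\<close>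

text \<open>Take \<open>J + M (x - c)\<close> with \<open>c\<close> from
  \<open>ex_eigenvalue_mod\<close>: if it contained 1, then \<open>x - c\<close> would have an
  inverse modulo \<open>J\<close>.\<close>

lemma ex_larger_proper_ideal:
  assumes "x \<in> M"
  shows "\<exists>c J'. proper_ideal M J' \<and> J \<subseteq> J' \<and> x - c *\<^sub>C 1 \<in> J'"
proof -
  obtain c where c: "\<And>b. b \<in> M \<Longrightarrow> b * (x - c *\<^sub>C 1) - 1 \<notin> J"
    using ex_eigenvalue_mod[OF assms] by blast
  define v where "v = x - c *\<^sub>C 1"
  have v: "v \<in> M"
    unfolding v_def by (intro diff_mem scaleC_mem one_mem assms)
  define J' where "J' = {j + u * v | j u. j \<in> J \<and> u \<in> M}"
  have J'I: "j + u * v \<in> J'" if "j \<in> J" "u \<in> M" for j u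
    using that by (auto simp: J'_def)
  have "proper_ideal M J'"
  proof unfold_locales
    show "J' \<subseteq> M"
      using ideal_subset v by (auto simp: J'_def intro!: add_mem mult_mem)
    show "0 \<in> J'"
      using J'I[OF ideal_zero zero_mem] by simp
  next
    fix y z assume "y \<in> J'" "z \<in> J'"
    then obtain j u k t where "j \<in> J" "u \<in> M" "k \<in> J" "t \<in> M" "y = j + u * v" "z = k + t * v"
      by (auto simp: J'_def)
    then show "y + z \<in> J'"
      using J'I[of "j + k" "u + t"] by (simp add: ideal_add add_mem algebra_simps)
  next
    fix y z assume "y \<in> M" "z \<in> J'"
    then obtain k t where "k \<in> J" "t \<in> M" "z = k + t * v"
      by (auto simp: J'_def)
    then show "y * z \<in> J'"
      using J'I[of "y * k" "y * t"] \<open>y \<in> M\<close> by (simp add: ideal_mult mult_mem algebra_simps)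
  next
    show "1 \<notin> J'"
    proof
      assume "1 \<in> J'"
      then obtain j u where ju: "j \<in> J" "u \<in> M" "1 = j + u * v"
        by (auto simp: J'_def)
      then have "u * v - 1 = 0 - j"
        by (simp add: algebra_simps)
      then show False
        using c[OF ju(2)] ideal_diff[OF ideal_zero ju(1)] by (simp add: v_def)
    qed
  qed
  moreover have "J \<subseteq> J'"
    using J'I[OF _ zero_mem] by auto
  moreover have "v \<in> J'"
    using J'I[OF ideal_zero one_mem] by simp
  ultimately show ?thesis
    unfolding v_def by blast
qed

end

text \<open>By commutativity in \<open>M\<close>, \<open>1 = u * x\<close> would make
  \<open>u\<close> a two-sided inverse of \<open>x\<close>.\<close>

lemma (in full_commutative_subalgebra) principal_proper_ideal:
  assumes "x \<in> M" "\<not> invertible_elem x"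
  shows "proper_ideal M {u * x | u. u \<in> M}"
proof unfold_locales
  show "{u * x | u. u \<in> M} \<subseteq> M"
    using assms mult_mem by auto
  show "0 \<in> {u * x | u. u \<in> M}"
    using zero_mem by force
  show "1 \<notin> {u * x | u. u \<in> M}"
    using assms commute by (force simp: invertible_elem_def)
next
  fix y z assume "y \<in> {u * x | u. u \<in> M}" "z \<in> {u * x | u. u \<in> M}"
  then show "y + z \<in> {u * x | u. u \<in> M}"
    by (auto intro: add_mem simp flip: distrib_right)
next
  fix y z assume "y \<in> M" "z \<in> {u * x | u. u \<in> M}"
  then show "y * z \<in> {u * x | u. u \<in> M}"
    by (auto intro: mult_mem simp flip: mult.assoc)
qed

text \<open>The ideals increase along the induction, so \<open>x\<close> and the differences already
  adjoined stay inside.\<close>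

lemma (in full_commutative_subalgebra) joint_eigenvalues_mod:
  assumes "x \<in> M" "\<not> invertible_elem x" "finite F" "\<And>i. i \<in> F \<Longrightarrow> a i \<in> M"
  shows "\<exists>c J. proper_ideal M J \<and> x \<in> J \<and> (\<forall>i\<in>F. a i - c i *\<^sub>C 1 \<in> J)"
  using assms(3,4)
proof (induction F)
  case empty
  have "x \<in> {u * x | u. u \<in> M}"
    using one_mem by force
  then show ?case
    using principal_proper_ideal[OF assms(1,2)] by auto
next
  case (insert i F)
  then obtain c J where J: "proper_ideal M J" "x \<in> J" "\<forall>i\<in>F. a i - c i *\<^sub>C 1 \<in> J"
    by auto
  obtain d J' where J': "proper_ideal M J'" "J \<subseteq> J'" "a i - d *\<^sub>C 1 \<in> J'"
    using proper_ideal.ex_larger_proper_ideal[OF J(1), of "a i"] insert by auto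
  have "\<forall>k\<in>insert i F. a k - (c(i := d)) k *\<^sub>C 1 \<in> J'"
    using J J' insert by auto
  then show ?case
    using J J' by blast
qed

section \<open>The bicommutant\<close>

definition commutant :: "'a::times set \<Rightarrow> 'a set"
  where "commutant S = {x. \<forall>s\<in>S. x * s = s * x}"

text \<open>A commuting \<open>S\<close> lies in its commutant. Taking commutants reverses
  inclusions, so the bicommutant lies in the commutant of \<open>S\<close>, with which it
  commutes.\<close>

lemma full_commutative_subalgebra_bicommutant:
  fixes S :: "'a::complex_banach_algebra set"
  assumes S: "\<And>x y. x \<in> S \<Longrightarrow> y \<in> S \<Longrightarrow> x * y = y * x"
  shows "full_commutative_subalgebra (commutant (commutant S))"
proof unfold_locales
  let ?M = "commutant (commutant S)"
  have "S \<subseteq> commutant S"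
    using S by (auto simp: commutant_def)
  then have sub: "?M \<subseteq> commutant S"
    unfolding commutant_def by blast
  show "1 \<in> ?M"
    by (simp add: commutant_def)
  fix x y assume x: "x \<in> ?M"
  show "c *\<^sub>C x \<in> ?M" for c
    using x by (simp add: commutant_def mult_scaleC_left mult_scaleC_right)
  show "y \<in> ?M" if "x * y = 1" "y * x = 1"
    unfolding commutant_def
  proof (intro CollectI ballI)
    fix s assume "s \<in> {x. \<forall>s\<in>S. x * s = s * x}"
    then have "x * s = s * x"
      using x by (auto simp: commutant_def)
    \<comment> \<open>Multiplying \<open>x * s = s * x\<close> by the inverse \<open>y\<close> on
      both sides moves the commutation to \<open>y\<close>.\<close>
    then have "y * (x * s) * y = y * (s * x) * y"
      by simp
    then show "y * s = s * y"
      using that by (metis mult.assoc mult_1_left mult_1_right)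
  qed
  assume y: "y \<in> ?M"
  show "x + y \<in> ?M"
    using x y by (simp add: commutant_def distrib_left distrib_right)
  show "x * y \<in> ?M"
    using x y unfolding commutant_def by (auto simp: mult.assoc) (metis mult.assoc)
  show "x * y = y * x"
    using x y sub by (auto simp: commutant_def)
qed

section \<open>Hyperplanes in the projective spectrum\<close>

text \<open>Two coordinates suffice: a unit vector if \<open>z $ p = 0\<close>, otherwise
  \<open>- z $ r\<close> at \<open>p\<close> and \<open>z $ p\<close> at \<open>r\<close>, whose
  contributions cancel.\<close>

lemma ex_orthogonal_nonzero:
  fixes z :: "complex ^ 'k"
  assumes "CARD('k) > 1"
  shows "\<exists>a. a \<noteq> 0 \<and> (\<Sum>j\<in>UNIV. a $ j * z $ j) = 0"
proof -
  obtain p r :: 'k where pr: "p \<noteq> r"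
    using assms by (metis (full_types) One_nat_def card_le_Suc0_iff_eq finite less_le_not_le)
  show ?thesis
  proof (cases "z $ p = 0")
    case True
    have "axis p 1 \<noteq> (0 :: complex ^ 'k)"
      by (simp add: axis_eq_0_iff)
    moreover have "(\<Sum>j\<in>UNIV. axis p 1 $ j * z $ j) = 0"
      using True by (intro sum.neutral) (auto simp: axis_def)
    ultimately show ?thesis by blast
  next
    case False
    define a :: "complex ^ 'k" where "a = axis p (- z $ r) + axis r (z $ p)"
    have "a $ r \<noteq> 0"
      using pr False by (simp add: a_def axis_def)
    then have "a \<noteq> 0" by auto
    moreover have "(\<Sum>j\<in>UNIV. a $ j * z $ j) = (\<Sum>j\<in>{p, r}. a $ j * z $ j)"
      by (rule sum.mono_neutral_right) (auto simp: a_def axis_def)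
    then have "(\<Sum>j\<in>UNIV. a $ j * z $ j) = 0"
      using pr by (simp add: a_def axis_def)
    ultimately show ?thesis by blast
  qed
qed

theorem proposition2p2:
  fixes A :: "'a::complex_banach_algebra ^ 'k" and n :: nat
  assumes "n \<ge> 1"
    and "CARD('k) = n + 1"
    and "\<And>i j. (A $ i) * (A $ j) = (A $ j) * (A $ i)"
  shows "\<exists>\<H> :: (complex ^ 'k) set set.
           (\<forall>H\<in>\<H>. complex_hyperplane H) \<and> proj_spectrum A = \<Union>\<H>"
proof -
  define M where "M = commutant (commutant (range (\<lambda>j. A $ j)))"
  interpret full_commutative_subalgebra M
    unfolding M_def by (rule full_commutative_subalgebra_bicommutant) (use assms(3) in auto)
  have A: "A $ j \<in> M" for j
    by (simp add: M_def commutant_def)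
  have pencil_mem: "pencil A z \<in> M" for z
    unfolding pencil_def by (intro sum_mem scaleC_mem A)
  have "\<exists>H. complex_hyperplane H \<and> z \<in> H \<and> H \<subseteq> proj_spectrum A" if z: "z \<in> proj_spectrum A" for z
  proof -
    obtain c J where J: "proper_ideal M J" "pencil A z \<in> J" "\<And>j. A $ j - c j *\<^sub>C 1 \<in> J"
      using joint_eigenvalues_mod[OF pencil_mem, of z UNIV "\<lambda>j. A $ j"] z A
      by (auto simp: proj_spectrum_def)
    interpret proper_ideal M J by (rule J(1))
    have eval: "pencil A w - (\<Sum>j\<in>UNIV. c j * w $ j) *\<^sub>C 1 \<in> J" for w
    proof -
      have "(\<Sum>j\<in>UNIV. w $ j *\<^sub>C (A $ j - c j *\<^sub>C 1)) \<in> J"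
        by (intro ideal_sum ideal_scaleC J)
      then show ?thesis
        by (simp add: pencil_def scaleC_diff_right scaleC_scaleC sum_subtractf scaleC_sum_left
            mult.commute)
    qed
    have zero: "(\<Sum>j\<in>UNIV. c j * z $ j) = 0"
    proof (rule ccontr)
      define s where "s = (\<Sum>j\<in>UNIV. c j * z $ j)"
      assume "(\<Sum>j\<in>UNIV. c j * z $ j) \<noteq> 0"
      then have "s \<noteq> 0" by (simp add: s_def)
      \<comment> \<open>Both \<open>pencil A z\<close> and its difference from the scalar
        \<open>s\<close> lie in \<open>J\<close>, hence so does \<open>s\<close>; dividing by
        \<open>s\<close> would put 1 into \<open>J\<close>.\<close>
      moreover have "(1 / s) *\<^sub>C (pencil A z - (pencil A z - s *\<^sub>C 1)) \<in> J"
        unfolding s_def by (intro ideal_scaleC ideal_diff J eval)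
      ultimately show False
        using ideal_proper by (simp add: scaleC_scaleC)
    qed
    have incl: "w \<in> proj_spectrum A" if "(\<Sum>j\<in>UNIV. c j * w $ j) = 0" for w
      using eval[of w] that not_invertible_ideal by (simp add: proj_spectrum_def)
    obtain a :: "complex ^ 'k" where a: "a \<noteq> 0" "(\<Sum>j\<in>UNIV. a $ j * z $ j) = 0"
      "{w. (\<Sum>j\<in>UNIV. a $ j * w $ j) = 0} \<subseteq> proj_spectrum A"
    proof (cases "\<forall>j. c j = 0")
      case True
      \<comment> \<open>Here \<open>incl\<close> puts every point into the spectrum, so any
        hyperplane through \<open>z\<close> is contained in it.\<close>
      then show ?thesis
        using ex_orthogonal_nonzero[of z] incl assms(1,2) that by (auto simp: subset_iff)
    next
      case False
      then have "(\<chi> j. c j) \<noteq> 0"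
        by (auto simp: vec_eq_iff)
      then show ?thesis
        using zero incl by (intro that[of "\<chi> j. c j"]) auto
    qed
    then show ?thesis
      by (intro exI[of _ "{w. (\<Sum>j\<in>UNIV. a $ j * w $ j) = 0}"]) (auto simp: complex_hyperplane_def)
  qed
  then show ?thesis
    \<comment> \<open>The family of all hyperplanes inside the spectrum covers it, since each of its
      points lies on one of them.\<close>
    by (intro exI[of _ "{H. complex_hyperplane H \<and> H \<subseteq> proj_spectrum A}"]) blast
qed

end
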